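(* Let $\varrho$ be the substitution $\varrho({\tt a})={\tt a}{\tt a}{\tt b}$, $\varrho({\tt b})={\tt a}{\tt b}$. Write the Fibonacci word ${\tt f}=f_0f_1f_2\cdots$ as the concatenation of level-$2$ supertiles ${\tt f}=\varrho_F^2(f_0)\varrho_F^2(f_1)\varrho_F^2(f_2)\cdots$, where $\varrho_F^2({\tt a})={\tt a}{\tt b}{\tt a}$ and $\varrho_F^2({\tt b})={\tt a}{\tt b}$. Let ${\tt w}$ be the word obtained by replacing each supertile ${\tt a}{\tt b}{\tt a}=\varrho_F^2({\tt a})$ by $\varrho({\tt a})={\tt a}{\tt a}{\tt b}$ and keeping each supertile ${\tt a}{\tt b}=\varrho_F^2({\tt b})=\varrho({\tt b})$ unchanged. Then ${\tt w}=\varrho({\tt f})=D({\tt f})$.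
   Context: The Fibonacci word ${\tt f}$ is the fixed point of $\varrho_F:{\tt a}\mapsto{\tt a}{\tt b},\ {\tt b}\mapsto{\tt a}$ (so ${\tt f}=\varrho_F^2({\tt f})$). $D$ deletes the first occurrence of ${\tt a}$ and the first occurrence of ${\tt b}$ in a word. *)

theory Defs
  imports "HOL-Library.Stream"
begin

datatype letter = A | B

type_synonym 'a substitution = "'a \<Rightarrow> 'a list"

definition subst_word :: "'a substitution \<Rightarrow> 'a list \<Rightarrow> 'a list" where
  "subst_word \<sigma> u = concat (map \<sigma> u)"

text \<open>Meaningful for non-erasing substitutions only, since \<^const>\<open>flat\<close> is
  unspecified on streams containing the empty list.\<close>

definition subst_inf :: "'a substitution \<Rightarrow> 'a stream \<Rightarrow> 'a stream" where
  "subst_inf \<sigma> s = flat (smap \<sigma> s)"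

definition supertile :: "'a substitution \<Rightarrow> nat \<Rightarrow> 'a \<Rightarrow> 'a list" where
  "supertile \<sigma> n x = (subst_word \<sigma> ^^ n) [x]"

fun rho_F :: "letter substitution" where
  "rho_F A = [A, B]"
| "rho_F B = [A]"

fun rho :: "letter substitution" where
  "rho A = [A, A, B]"
| "rho B = [A, B]"

definition fib_word :: "letter stream" where
  "fib_word = (THE s. subst_inf rho_F s = s)"

text \<open>A word in which the letter does not occur is left unchanged.\<close>

definition delete_first :: "'a \<Rightarrow> 'a stream \<Rightarrow> 'a stream" where
  "delete_first c s =
     (if c \<in> sset s
      then let n = (LEAST n. s !! n = c) in stake n s @- sdrop (Suc n) s
      else s)"

text \<open>The two deletions concern different letters, so their order is immaterial.\<close>

definition D :: "letter stream \<Rightarrow> letter stream" where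
  "D s = delete_first B (delete_first A s)"

definition replace_supertile :: "letter list \<Rightarrow> letter list" where
  "replace_supertile u = (if u = supertile rho_F 2 A then rho A else u)"

lemma supertile_rho_F_2: "supertile rho_F 2 A = [A, B, A]" "supertile rho_F 2 B = [A, B]"
  by (simp_all add: supertile_def subst_word_def numeral_2_eq_2)

lemma replace_supertile_simps:
  "replace_supertile (supertile rho_F 2 A) = rho A"
  "replace_supertile (supertile rho_F 2 B) = supertile rho_F 2 B"
  "supertile rho_F 2 B = rho B"
  by (simp_all add: replace_supertile_def supertile_rho_F_2)

text \<open>The fixed point exists and is unique, so the definite description above is proper.\<close>

lemma stream_eqI: "(\<And>n. s !! n = t !! n) \<Longrightarrow> s = t"
  using smap_alt[of id s t] by (simp add: stream.map_id)

lemma subst_inf_SCons: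
  assumes "\<And>x. \<sigma> x \<noteq> []"
  shows "subst_inf \<sigma> (x ## s) = \<sigma> x @- subst_inf \<sigma> s"
  using assms by (simp add: subst_inf_def)

lemma subst_inf_shift:
  assumes "\<And>x. \<sigma> x \<noteq> []"
  shows "subst_inf \<sigma> (u @- s) = subst_word \<sigma> u @- subst_inf \<sigma> s"
  by (induction u) (simp_all add: subst_word_def subst_inf_SCons[OF assms])

lemma rho_F_nonempty: "rho_F x \<noteq> []"
  by (cases x) simp_all

lemma subst_word_append: "subst_word \<sigma> (u @ v) = subst_word \<sigma> u @ subst_word \<sigma> v"
  by (simp add: subst_word_def)

lemma supertile_Suc: "supertile \<sigma> (Suc n) x = subst_word \<sigma> (supertile \<sigma> n x)"
  by (simp add: supertile_def)

lemma supertile_A_Suc: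
  "\<exists>v. v \<noteq> [] \<and> supertile rho_F (Suc n) A = supertile rho_F n A @ v"
proof (induction n)
  case 0
  show ?case by (simp add: supertile_def subst_word_def)
next
  case (Suc n)
  then obtain v where v: "v \<noteq> []" "supertile rho_F (Suc n) A = supertile rho_F n A @ v"
    by blast
  have "supertile rho_F (Suc (Suc n)) A = supertile rho_F (Suc n) A @ subst_word rho_F v"
    by (subst supertile_Suc, subst v(2)) (simp add: subst_word_append supertile_Suc)
  moreover have "subst_word rho_F v \<noteq> []"
    using v(1) by (cases v) (simp_all add: subst_word_def rho_F_nonempty)
  ultimately show ?case by blast
qed

lemma length_supertile_A: "n < length (supertile rho_F n A)"
proof (induction n)
  case 0
  show ?case by (simp add: supertile_def)
next
  case (Suc n)
  obtain v where "v \<noteq> []" "supertile rho_F (Suc n) A = supertile rho_F n A @ v"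
    using supertile_A_Suc by blast
  with Suc show ?case by (cases v) simp_all
qed

lemma supertile_A_prefix: "\<exists>v. supertile rho_F (n + k) A = supertile rho_F n A @ v"
proof (induction k)
  case (Suc k)
  then obtain v where v: "supertile rho_F (n + k) A = supertile rho_F n A @ v" by blast
  obtain v' where "supertile rho_F (Suc (n + k)) A = supertile rho_F (n + k) A @ v'"
    using supertile_A_Suc by blast
  then show ?case by (simp add: v)
qed simp

lemma stream_eq_supertiles:
  assumes "\<And>n. \<exists>s'. s = supertile rho_F n A @- s'"
    and "\<And>n. \<exists>t'. t = supertile rho_F n A @- t'"
  shows "s = t"
proof -
  have "s !! n = t !! n" for n
    using assms[of n] length_supertile_A[of n] by auto
  then show ?thesis
    by (intro stream_eqI)
qed

lemma fixed_point_supertiles: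
  assumes "subst_inf rho_F s = s"
  shows "\<exists>s'. s = supertile rho_F n A @- s'"
proof (induction n)
  case 0
  have "subst_inf rho_F s = rho_F (shd s) @- subst_inf rho_F (stl s)"
    using subst_inf_SCons[of rho_F "shd s" "stl s", OF rho_F_nonempty] by simp
  then have "s = rho_F (shd s) @- subst_inf rho_F (stl s)" by (simp only: assms)
  moreover have "hd (rho_F x) = A" for x by (cases x) simp_all
  ultimately have "shd s = A" by (metis rho_F_nonempty shift_simps(1))
  then have "s = [A] @- stl s" by (cases s) simp
  then have "s = supertile rho_F 0 A @- stl s" by (simp only: supertile_def funpow_0)
  then show ?case by (rule exI)
next
  case (Suc n)
  then obtain s' where "s = supertile rho_F n A @- s'" by blast
  then have "subst_inf rho_F s = supertile rho_F (Suc n) A @- subst_inf rho_F s'"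
    by (simp add: subst_inf_shift[OF rho_F_nonempty] supertile_Suc)
  then show ?case unfolding assms by (rule exI)
qed

lemma ex1_fixed_point: "\<exists>!s. subst_inf rho_F s = s"
proof (rule ex_ex1I)
  define s where "s = smap (\<lambda>n. supertile rho_F n A ! n) nats"
  have pre: "\<exists>s'. s = supertile rho_F n A @- s'" for n
  proof -
    let ?W = "supertile rho_F n A"
    have "stake (length ?W) s = ?W"
    proof (rule nth_equalityI)
      fix i assume "i < length (stake (length ?W) s)"
      then have i: "i < length ?W" by simp
      have "supertile rho_F i A ! i = ?W ! i"
      proof (cases "i \<le> n")
        case True
        then show ?thesis
          using supertile_A_prefix[of i "n - i"] length_supertile_A[of i]
          by (auto simp: nth_append)
      next
        case False
        then show ?thesis
          using supertile_A_prefix[of n "i - n"] i by (auto simp: nth_append)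
      qed
      with i show "stake (length ?W) s ! i = ?W ! i"
        by (simp add: s_def)
    qed simp
    then have "s = ?W @- sdrop (length ?W) s"
      using stake_sdrop[of "length ?W" s] by (simp only:)
    then show ?thesis by (rule exI)
  qed
  have "\<exists>t. subst_inf rho_F s = supertile rho_F n A @- t" for n
  proof -
    obtain s' where "s = supertile rho_F n A @- s'" using pre by blast
    then have "subst_inf rho_F s = supertile rho_F (Suc n) A @- subst_inf rho_F s'"
      by (simp add: subst_inf_shift[OF rho_F_nonempty] supertile_Suc)
    moreover obtain v where "supertile rho_F (Suc n) A = supertile rho_F n A @ v"
      using supertile_A_Suc by blast
    ultimately show ?thesis by auto
  qed
  then have "subst_inf rho_F s = s" using pre by (rule stream_eq_supertiles)
  then show "\<exists>s. subst_inf rho_F s = s" ..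
next
  fix s t assume "subst_inf rho_F s = s" "subst_inf rho_F t = t"
  then show "s = t"
    using stream_eq_supertiles[OF fixed_point_supertiles fixed_point_supertiles] by blast
qed

lemma fib_word_fixed: "subst_inf rho_F fib_word = fib_word"
  unfolding fib_word_def by (rule theI'[OF ex1_fixed_point])

lemma flat_supertiles_2: "flat (smap (supertile rho_F 2) s) = subst_inf rho_F (subst_inf rho_F s)"
proof -
  have ne: "supertile rho_F 2 x \<noteq> []" for x by (cases x) (simp_all add: supertile_rho_F_2)
  have st: "supertile rho_F 2 x = subst_word rho_F (rho_F x)" for x
    by (simp add: supertile_def subst_word_def numeral_2_eq_2)
  have step: "subst_inf (supertile rho_F 2) s =
      supertile rho_F 2 (shd s) @- subst_inf (supertile rho_F 2) (stl s)" for s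
    using subst_inf_SCons[of "supertile rho_F 2" "shd s" "stl s", OF ne] by simp
  have step': "subst_inf rho_F (subst_inf rho_F s) =
      supertile rho_F 2 (shd s) @- subst_inf rho_F (subst_inf rho_F (stl s))" for s
    using subst_inf_SCons[of rho_F "shd s" "stl s", OF rho_F_nonempty]
    by (simp add: subst_inf_shift[OF rho_F_nonempty] st)
  have "subst_inf (supertile rho_F 2) s !! n = subst_inf rho_F (subst_inf rho_F s) !! n" for n
  proof (induction n arbitrary: s rule: less_induct)
    case (less n)
    let ?l = "length (supertile rho_F 2 (shd s))"
    have "?l > 0" using ne by simp
    then have "n - ?l < n" if "\<not> n < ?l" using that by linarith
    with less[of "n - ?l" "stl s"] show ?case
      by (subst step, subst step') (cases "n < ?l"; simp)
  qed
  then have "subst_inf (supertile rho_F 2) s = subst_inf rho_F (subst_inf rho_F s)"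
    by (intro stream_eqI)
  then show ?thesis by (simp only: subst_inf_def)
qed

lemma fib_word_supertiles: "fib_word = flat (smap (supertile rho_F 2) fib_word)"
  by (simp add: flat_supertiles_2 fib_word_fixed)

end

theory Submission
  imports Defs
begin

text \<open>The substitutions \<^const>\<open>rho\<close> and \<open>supertile rho_F 2\<close> are conjugate: for each letter \<open>x\<close>,
  \<open>ab \<cdot> rho x = supertile rho_F 2 x \<cdot> ab\<close>. Moving the prefix \<open>ab\<close> through the image of an
  infinite word letter by letter gives \<open>ab \<cdot> rho s = rho_F (rho_F s)\<close> for every \<open>s\<close>, hence
  \<open>ab \<cdot> rho f = f\<close> for the Fibonacci word; and deleting this prefix is what \<^const>\<open>D\<close> does
  to a word starting with \<open>ab\<close>.\<close>

text \<open>Since \<open>\<sigma> x\<close> is nonempty, peeling off one image strictly lowers the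
  position compared, so strong induction on it applies.\<close>

lemma subst_inf_unique:
  assumes nonempty: "\<And>x. \<sigma> x \<noteq> []"
    and step: "\<And>x s. g (x ## s) = \<sigma> x @- g s"
  shows "g s = subst_inf \<sigma> s"
proof (rule stream_eqI)
  fix n
  show "g s !! n = subst_inf \<sigma> s !! n"
  proof (induction n arbitrary: s rule: less_induct)
    case (less n)
    obtain x t where s: "s = x ## t" by (cases s)
    have "n - length (\<sigma> x) < n" if "\<not> n < length (\<sigma> x)"
      using that nonempty[of x] by (cases "\<sigma> x") simp_all
    with less[of "n - length (\<sigma> x)" t] show ?case
      by (cases "n < length (\<sigma> x)") (simp_all add: s step subst_inf_SCons[OF nonempty])
  qed
qed

lemma rho_nonempty: "rho x \<noteq> []"
  by (cases x) simp_all

lemma shift_subst_inf_rho: "[A, B] @- subst_inf rho s = subst_inf (supertile rho_F 2) s"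
proof (rule subst_inf_unique[where g = "\<lambda>s. [A, B] @- subst_inf rho s"])
  show "supertile rho_F 2 x \<noteq> []" for x
    by (cases x) (simp_all add: supertile_rho_F_2)
  show "[A, B] @- subst_inf rho (x ## s) = supertile rho_F 2 x @- [A, B] @- subst_inf rho s"
    for x s
    by (cases x) (simp_all add: subst_inf_SCons[OF rho_nonempty] supertile_rho_F_2)
qed

lemma fib_word_eq_shift_rho: "fib_word = [A, B] @- subst_inf rho fib_word"
  unfolding shift_subst_inf_rho unfolding subst_inf_def by (rule fib_word_supertiles)

lemma delete_first_SCons_same: "delete_first c (c ## s) = s"
proof -
  have "(LEAST n. (c ## s) !! n = c) = 0"
    by (rule Least_eq_0) simp
  then show ?thesis
    by (simp add: delete_first_def)
qed

text \<open>Removing the leading \<open>A\<close> brings \<open>B\<close> to the head, so both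
  deletions act at position 0.\<close>

lemma D_shift_AB: "D ([A, B] @- s) = s"
  by (simp add: D_def delete_first_SCons_same)

lemma replace_supertile_level_2: "replace_supertile (supertile rho_F 2 x) = rho x"
  by (cases x) (simp_all add: replace_supertile_def supertile_rho_F_2)

theorem theorem4p9:
  fixes w :: "letter stream"
  assumes "w = flat (smap replace_supertile (smap (supertile rho_F 2) fib_word))"
  shows "w = subst_inf rho fib_word \<and> subst_inf rho fib_word = D fib_word"
proof
  have "replace_supertile \<circ> supertile rho_F 2 = rho"
    by (simp add: fun_eq_iff replace_supertile_level_2)
  then show "w = subst_inf rho fib_word"
    by (simp add: assms subst_inf_def stream.map_comp)
  show "subst_inf rho fib_word = D fib_word"
    \<comment> \<open>Only the occurrence under \<open>D\<close> is expanded; the left side already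
      is the tail that \<open>D\<close> leaves.\<close>
    by (subst (2) fib_word_eq_shift_rho) (simp only: D_shift_AB)
qed

end
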